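(* For any total functions $f,g,h\colon\omega\to\omega$, if $f\cap g\leq_{\rm subT} h$, then $f\leq_{\rm subT} h$ or $g\leq_{\rm subT} h$.
   Context: For a partial computable function $\Phi$ from finite sequences of natural numbers to $\{0,1\}\times\omega$ and a partial function $g\colon\subseteq\omega\to\omega$, the $g$-relative sequential computation $\Phi[g]$ is defined as follows. On input $n$, with oracle answers $a_0,\dots,a_{s-1}$ obtained so far: if $\Phi(n,a_0,\dots,a_{s-1})$ is undefined, $\Phi[g](n)$ is undefined; if it equals $\langle 1,q\rangle$ the computation halts with output $q$; if it equals $\langle 0,q\rangle$, $q$ is a query, and if $q\in{\rm dom}(g)$ the computation continues with $a_s=g(q)$, while if $q\notin{\rm dom}(g)$ the computation never halts. $\Phi_e$ is the $e$-th such partial computable function. $f\leq_{\rm subT} g$ means $f\subseteq\Phi_e[g]$ for some $e$. The meet $f\cap g$ is the partial function with $(f\cap g)(\langle d,e,n\rangle)=\Phi_d[f](n)$ if $\Phi_d[f](n)$ and $\Phi_e[g](n)$ are both defined and equal, and undefined otherwise; it is the greatest lower bound of $f$ and $g$ under $\leq_{\rm subT}$. *)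

theory Defs
  imports Main "HOL-Library.Nat_Bijection" "HOL-Library.Monad_Syntax"
begin

text \<open>
  Programs for the unary partial recursive functions over the Cantor pairing: the class containing
  zero, successor and the two projections and closed under pairing, composition, primitive recursion
  and unbounded minimisation. Functions of several arguments are treated by pairing.
\<close>

datatype prog =
    Zero
  | Succ
  | Fst
  | Snd
  | Pair prog prog
  | Comp prog prog
  | Prec prog prog
  | Mu prog

primrec eval_prog :: "prog \<Rightarrow> nat \<Rightarrow> nat option" where
  "eval_prog Zero = (\<lambda>x. Some 0)"
| "eval_prog Succ = (\<lambda>x. Some (Suc x))"
| "eval_prog Fst = (\<lambda>x. Some (fst (prod_decode x)))"
| "eval_prog Snd = (\<lambda>x. Some (snd (prod_decode x)))"
| "eval_prog (Pair p q) = (\<lambda>x. do {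
     u \<leftarrow> eval_prog p x;
     v \<leftarrow> eval_prog q x;
     Some (prod_encode (u, v)) })"
| "eval_prog (Comp p q) = (\<lambda>x. do { u \<leftarrow> eval_prog q x; eval_prog p u })"
| "eval_prog (Prec p q) = (\<lambda>x. case prod_decode x of (a, k) \<Rightarrow>
     rec_nat (eval_prog p a)
       (\<lambda>i r. do { v \<leftarrow> r; eval_prog q (prod_encode (a, prod_encode (i, v))) }) k)"
| "eval_prog (Mu p) = (\<lambda>x.
     let is_min = (\<lambda>k. eval_prog p (prod_encode (x, k)) = Some 0 \<and>
                       (\<forall>j<k. \<exists>v. eval_prog p (prod_encode (x, j)) = Some (Suc v)))
     in if \<exists>k. is_min k then Some (THE k. is_min k) else None)"

function prog_of :: "nat \<Rightarrow> prog" where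
  "prog_of e =
     (if e = 0 then Zero
      else if e = 1 then Succ
      else if e = 2 then Fst
      else if e = 3 then Snd
      else let m = (e - 4) div 4; i = fst (prod_decode m); j = snd (prod_decode m) in
        if e mod 4 = 0 then Pair (prog_of i) (prog_of j)
        else if e mod 4 = 1 then Comp (prog_of i) (prog_of j)
        else if e mod 4 = 2 then Prec (prog_of i) (prog_of j)
        else Mu (prog_of m))"
  by pat_completeness auto
termination
proof (relation "measure id", goal_cases)
  have fst_le: "fst (prod_decode m) \<le> m" and snd_le: "snd (prod_decode m) \<le> m" for m
    using le_prod_encode_1[of "fst (prod_decode m)" "snd (prod_decode m)"]
      le_prod_encode_2[of "snd (prod_decode m)" "fst (prod_decode m)"] by simp_all
  have small: "(e - 4) div 4 < e" if "e \<noteq> 0" for e :: nat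
    using that by linarith
  {
    case 1 show ?case by simp
  next
    case 2 then show ?case using le_less_trans[OF fst_le small] by simp
  next
    case 3 then show ?case using le_less_trans[OF snd_le small] by simp
  next
    case 4 then show ?case using le_less_trans[OF fst_le small] by simp
  next
    case 5 then show ?case using le_less_trans[OF snd_le small] by simp
  next
    case 6 then show ?case using le_less_trans[OF fst_le small] by simp
  next
    case 7 then show ?case using le_less_trans[OF snd_le small] by simp
  next
    case 8 then show ?case using small by simp
  }
qed

declare prog_of.simps [simp del]

lemma surj_prog_of: "\<exists>e. prog_of e = p"
proof (induction p)
  case Zero
  have "prog_of 0 = Zero" by (subst prog_of.simps) simp
  then show ?case ..
next
  case Succ
  have "prog_of 1 = Succ" by (subst prog_of.simps) simp
  then show ?case ..
next
  case Fst
  have "prog_of 2 = Fst" by (subst prog_of.simps) simp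
  then show ?case ..
next
  case Snd
  have "prog_of 3 = Snd" by (subst prog_of.simps) simp
  then show ?case ..
next
  case (Pair p q)
  then obtain i j where "prog_of i = p" "prog_of j = q" by blast
  then have "prog_of (4 * prod_encode (i, j) + 4) = Pair p q"
    by (subst prog_of.simps) (simp add: Let_def)
  then show ?case ..
next
  case (Comp p q)
  then obtain i j where "prog_of i = p" "prog_of j = q" by blast
  moreover have "(4 * m + 5) mod 4 = 1" "(4 * m + 1) div 4 = m" for m :: nat by presburger+
  ultimately have "prog_of (4 * prod_encode (i, j) + 5) = Comp p q"
    by (subst prog_of.simps) (simp add: Let_def)
  then show ?case ..
next
  case (Prec p q)
  then obtain i j where "prog_of i = p" "prog_of j = q" by blast
  moreover have "(4 * m + 6) mod 4 = 2" "(4 * m + 2) div 4 = m" for m :: nat by presburger+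
  ultimately have "prog_of (4 * prod_encode (i, j) + 6) = Prec p q"
    by (subst prog_of.simps) (simp add: Let_def)
  then show ?case ..
next
  case (Mu p)
  then obtain m where "prog_of m = p" by blast
  moreover have "(4 * m + 7) mod 4 = 3" "(4 * m + 3) div 4 = m" for m :: nat by presburger+
  ultimately have "prog_of (4 * m + 7) = Mu p"
    by (subst prog_of.simps) (simp add: Let_def)
  then show ?case ..
qed

text \<open>
  The \<open>e\<close>-th partial computable function from finite sequences of natural numbers to
  \<open>{0,1} \<times> \<omega>\<close>. The flag 1 (halt) is \<open>True\<close>, the flag 0 (query) is \<open>False\<close>; the pair
  \<open>(b, q)\<close> is coded by the number \<open>2 * q + b\<close>.
\<close>

definition Phi :: "nat \<Rightarrow> nat list \<Rightarrow> (bool \<times> nat) option" where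
  "Phi e xs = map_option (\<lambda>v. (odd v, v div 2)) (eval_prog (prog_of e) (list_encode xs))"

text \<open>
  Here \<open>xs\<close> is the input followed by the oracle answers received so far. The least fixed point
  makes an infinite sequence of queries undefined.
\<close>

partial_function (option) seq_run ::
  "(nat list \<Rightarrow> (bool \<times> nat) option) \<Rightarrow> (nat \<Rightarrow> nat option) \<Rightarrow> nat list \<Rightarrow> nat option" where
  "seq_run \<Phi> g xs = do {
     (halt, q) \<leftarrow> \<Phi> xs;
     if halt then Some q else do { a \<leftarrow> g q; seq_run \<Phi> g (xs @ [a]) } }"

definition seq_comp ::
  "(nat list \<Rightarrow> (bool \<times> nat) option) \<Rightarrow> (nat \<Rightarrow> nat option) \<Rightarrow> nat \<Rightarrow> nat option" where
  "seq_comp \<Phi> g n = seq_run \<Phi> g [n]"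

definition subT_le :: "(nat \<Rightarrow> nat option) \<Rightarrow> (nat \<Rightarrow> nat option) \<Rightarrow> bool"
    (infix "\<le>\<^sub>s\<^sub>u\<^sub>b\<^sub>T" 50) where
  "f \<le>\<^sub>s\<^sub>u\<^sub>b\<^sub>T g \<longleftrightarrow> (\<exists>e. f \<subseteq>\<^sub>m seq_comp (Phi e) g)"

text \<open>The argument is the triple \<open>\<langle>d, e, n\<rangle>\<close>, coded as \<open>\<langle>d, \<langle>e, n\<rangle>\<rangle>\<close>.\<close>

definition subT_meet :: "(nat \<Rightarrow> nat option) \<Rightarrow> (nat \<Rightarrow> nat option) \<Rightarrow> nat \<Rightarrow> nat option"
    (infixl "\<sqinter>\<^sub>s\<^sub>u\<^sub>b\<^sub>T" 70) where
  "(f \<sqinter>\<^sub>s\<^sub>u\<^sub>b\<^sub>T g) x =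
     (let (d, y) = prod_decode x; (e, n) = prod_decode y in
      if seq_comp (Phi d) f n \<noteq> None \<and> seq_comp (Phi d) f n = seq_comp (Phi e) g n
      then seq_comp (Phi d) f n else None)"

end

theory Submission
  imports Defs "HOL.Filter"
begin

text \<open>
  Suppose that \<open>\<Phi>[h]\<close> extends the meet of \<open>f\<close> and \<open>g\<close>. Fix indices \<open>d\<close> and \<open>e\<close> such that on
  input \<open>\<langle>\<langle>a, b\<rangle>, \<langle>u, v\<rangle>\<rangle>\<close> the first asks whether \<open>f a = u\<close> and the second whether \<open>g b = v\<close>,
  answering 0 for yes and 1 for no. Let \<open>S a b\<close> be the set of pairs \<open>(u, v)\<close> for which \<open>\<Phi>[h]\<close>
  returns 0 on the corresponding argument of the meet. It is enumerable in \<open>h\<close>, contains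
  \<open>(f a, g b)\<close>, and is contained in the cross \<open>u = f a \<or> v = g b\<close>, because off the cross both
  answers are 1.

  Hence two distinct points of \<open>S a b\<close> with the same second coordinate \<open>v\<close> certify \<open>v = g b\<close>. If
  for every \<open>b\<close> some \<open>a\<close> provides such a certificate, then \<open>g\<close> is computed from \<open>h\<close> by searching
  for one. Otherwise some fixed \<open>b\<close> has none, so every point of \<open>S a b\<close> has first coordinate
  \<open>f a\<close>, and \<open>f\<close> is computed from \<open>h\<close> by searching for any point.
\<close>

section \<open>Total recursive functions\<close>

abbreviation p1 :: "nat \<Rightarrow> nat" where "p1 z \<equiv> fst (prod_decode z)"
abbreviation p2 :: "nat \<Rightarrow> nat" where "p2 z \<equiv> snd (prod_decode z)"

definition recfn :: "(nat \<Rightarrow> nat) \<Rightarrow> bool" where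
  "recfn F \<longleftrightarrow> (\<exists>p. \<forall>x. eval_prog p x = Some (F x))"

named_theorems recfn_intros

lemma recfn_comp: "recfn F \<Longrightarrow> recfn G \<Longrightarrow> recfn (\<lambda>x. F (G x))"
  unfolding recfn_def
proof (elim exE)
  fix p q assume "\<forall>x. eval_prog p x = Some (F x)" "\<forall>x. eval_prog q x = Some (G x)"
  then have "\<forall>x. eval_prog (Comp p q) x = Some (F (G x))" by simp
  then show "\<exists>p. \<forall>x. eval_prog p x = Some (F (G x))" ..
qed

lemma recfn_pair [recfn_intros]:
  "recfn F \<Longrightarrow> recfn G \<Longrightarrow> recfn (\<lambda>x. prod_encode (F x, G x))"
  unfolding recfn_def
proof (elim exE)
  fix p q assume "\<forall>x. eval_prog p x = Some (F x)" "\<forall>x. eval_prog q x = Some (G x)"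
  then have "\<forall>x. eval_prog (Pair p q) x = Some (prod_encode (F x, G x))" by simp
  then show "\<exists>p. \<forall>x. eval_prog p x = Some (prod_encode (F x, G x))" ..
qed

lemma recfn_Suc [recfn_intros]: "recfn F \<Longrightarrow> recfn (\<lambda>x. Suc (F x))"
  by (rule recfn_comp[of Suc]) (auto simp: recfn_def intro!: exI[of _ Succ])

lemma recfn_p1 [recfn_intros]: "recfn F \<Longrightarrow> recfn (\<lambda>x. p1 (F x))"
  by (rule recfn_comp[of p1]) (auto simp: recfn_def intro!: exI[of _ Fst])

lemma recfn_p2 [recfn_intros]: "recfn F \<Longrightarrow> recfn (\<lambda>x. p2 (F x))"
  by (rule recfn_comp[of p2]) (auto simp: recfn_def intro!: exI[of _ Snd])

lemma recfn_const [recfn_intros]: "recfn (\<lambda>x. c)"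
proof (induction c)
  case 0
  show ?case by (auto simp: recfn_def intro!: exI[of _ Zero])
next
  case (Suc c)
  then show ?case by (rule recfn_Suc)
qed

lemma recfn_id [recfn_intros]: "recfn (\<lambda>x. x)"
proof -
  have "\<forall>x. eval_prog (Pair Fst Snd) x = Some x" by simp
  then show ?thesis unfolding recfn_def by blast
qed

text \<open>\<open>Prec\<close> gives its step program one code of parameter, counter and
  accumulator, hence the uncurried premise on \<open>B\<close>. The input \<open>x\<close> itself
  serves as the parameter.\<close>

lemma recfn_rec [recfn_intros]:
  assumes "recfn A" "recfn (\<lambda>z. B (p1 z) (p1 (p2 z)) (p2 (p2 z)))" "recfn K"
  shows "recfn (\<lambda>x. rec_nat (A x) (B x) (K x))"
proof -
  obtain p q where p: "\<And>x. eval_prog p x = Some (A x)"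
    and q: "\<And>z. eval_prog q z = Some (B (p1 z) (p1 (p2 z)) (p2 (p2 z)))"
    using assms(1,2) unfolding recfn_def by blast
  have "rec_nat (eval_prog p a)
       (\<lambda>i r. do { v \<leftarrow> r; eval_prog q (prod_encode (a, prod_encode (i, v))) }) k
     = Some (rec_nat (A a) (B a) k)" for a k
    by (induction k) (simp_all add: p q)
  then have "\<forall>x. eval_prog (Prec p q) x = Some (rec_nat (A (p1 x)) (B (p1 x)) (p2 x))"
    by (simp add: case_prod_beta)
  then have "recfn (\<lambda>x. rec_nat (A (p1 x)) (B (p1 x)) (p2 x))" unfolding recfn_def by blast
  from recfn_comp[OF this recfn_pair[OF recfn_id assms(3)]] show ?thesis by simp
qed

lemma recfn_funpow [recfn_intros]:
  assumes "recfn (\<lambda>z. F (p1 z) (p2 z))" "recfn K" "recfn A"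
  shows "recfn (\<lambda>x. ((F x) ^^ (K x)) (A x))"
proof -
  have eq: "(F x ^^ k) a = rec_nat a (\<lambda>i r. F x r) k" for x k a
    by (induction k) simp_all
  have "recfn (\<lambda>z. F (p1 z) (p2 (p2 z)))"
    using recfn_comp[OF assms(1), of "\<lambda>z. prod_encode (p1 z, p2 (p2 z))"]
    by (simp add: recfn_intros)
  then show ?thesis unfolding eq by (intro recfn_intros assms)
qed

lemma recfn_pred [recfn_intros]:
  assumes "recfn F"
  shows "recfn (\<lambda>x. F x - 1)"
proof -
  have eq: "k - 1 = rec_nat 0 (\<lambda>i r. i) k" for k :: nat by (cases k) simp_all
  show ?thesis unfolding eq by (intro recfn_intros assms)
qed

lemma recfn_diff [recfn_intros]:
  assumes "recfn F" "recfn G"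
  shows "recfn (\<lambda>x. F x - G x)"
proof -
  have eq: "m - k = ((\<lambda>r. r - 1) ^^ k) m" for m k :: nat
    by (induction k) (simp_all flip: diff_Suc_eq_diff_pred)
  show ?thesis unfolding eq[of "F _"] by (intro recfn_intros assms)
qed

lemma recfn_if_zero:
  assumes "recfn C" "recfn A" "recfn B"
  shows "recfn (\<lambda>x. if C x = 0 then A x else B x)"
proof -
  have eq: "(if C x = 0 then A x else B x) = rec_nat (A x) (\<lambda>i r. B x) (C x)" for x
    by (cases "C x") simp_all
  show ?thesis unfolding eq by (intro recfn_intros assms recfn_comp[OF assms(3)])
qed

lemma recfn_if_eq [recfn_intros]:
  assumes "recfn F" "recfn G" "recfn A" "recfn B"
  shows "recfn (\<lambda>x. if F x = G x then A x else B x)"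
proof -
  \<comment> \<open>Numbers are equal iff both truncated differences vanish.\<close>
  have eq: "(if F x = G x then A x else B x) =
      (if F x - G x = 0 then (if G x - F x = 0 then A x else B x) else B x)" for x
    by auto
  show ?thesis unfolding eq by (intro recfn_if_zero recfn_diff assms)
qed

lemma recfn_parity [recfn_intros]:
  assumes "recfn F"
  shows "recfn (\<lambda>x. F x mod 2)"
proof -
  have eq: "k mod 2 = ((\<lambda>r. if r = 0 then 1 else 0) ^^ k) (0::nat)" for k :: nat
    by (induction k) (auto simp: mod_Suc)
  show ?thesis unfolding eq by (intro recfn_intros assms)
qed

lemma recfn_half [recfn_intros]:
  assumes "recfn F"
  shows "recfn (\<lambda>x. F x div 2)"
proof -
  have eq: "k div 2 = rec_nat (0::nat) (\<lambda>i r. if i mod 2 = 0 then r else Suc r) k" for k :: nat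
  proof (induction k)
    case (Suc k)
    have "Suc k div 2 = (if k mod 2 = 0 then k div 2 else Suc (k div 2))" by presburger
    with Suc show ?case by simp
  qed simp
  show ?thesis unfolding eq by (intro recfn_intros assms)
qed

lemma recfn_double [recfn_intros]:
  assumes "recfn F"
  shows "recfn (\<lambda>x. 2 * F x)"
proof -
  have eq: "2 * k = ((\<lambda>r. Suc (Suc r)) ^^ k) (0::nat)" for k :: nat
    by (induction k) simp_all
  show ?thesis unfolding eq by (intro recfn_intros assms)
qed

section \<open>Operations on list codes\<close>

text \<open>A nonempty list is coded as \<open>Suc\<close> of a pair, so subtracting 1 exposes head
  and tail.\<close>

definition chd :: "nat \<Rightarrow> nat" where "chd c = p1 (c - 1)"
definition ctl :: "nat \<Rightarrow> nat" where "ctl c = p2 (c - 1)"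
definition cdrop :: "nat \<Rightarrow> nat \<Rightarrow> nat" where "cdrop k c = (ctl ^^ k) c"
text \<open>A list is never longer than its code, so \<open>c\<close> itself bounds the
  recursion.\<close>

definition clength :: "nat \<Rightarrow> nat" where
  "clength c = rec_nat 0 (\<lambda>i r. if cdrop i c = 0 then r else Suc r) c"
definition crev :: "nat \<Rightarrow> nat" where
  "crev c = rec_nat 0
     (\<lambda>i r. if cdrop i c = 0 then r else Suc (prod_encode (chd (cdrop i c), r))) c"

lemma recfn_chd [recfn_intros]: "recfn F \<Longrightarrow> recfn (\<lambda>x. chd (F x))"
  unfolding chd_def by (intro recfn_intros)

lemma recfn_ctl [recfn_intros]: "recfn F \<Longrightarrow> recfn (\<lambda>x. ctl (F x))"
  unfolding ctl_def by (intro recfn_intros)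

lemma recfn_cdrop [recfn_intros]: "recfn K \<Longrightarrow> recfn F \<Longrightarrow> recfn (\<lambda>x. cdrop (K x) (F x))"
  unfolding cdrop_def by (intro recfn_intros)

lemma recfn_clength [recfn_intros]: "recfn F \<Longrightarrow> recfn (\<lambda>x. clength (F x))"
  by (rule recfn_comp[of "\<lambda>c. clength c"]) (unfold clength_def, intro recfn_intros)

lemma recfn_crev [recfn_intros]: "recfn F \<Longrightarrow> recfn (\<lambda>x. crev (F x))"
  by (rule recfn_comp[of "\<lambda>c. crev c"]) (unfold crev_def, intro recfn_intros)

lemma list_encode_eq_0_iff [simp]: "list_encode xs = 0 \<longleftrightarrow> xs = []"
  by (cases xs) simp_all

lemma chd_Cons [simp]: "chd (Suc (prod_encode (x, c))) = x"
  by (simp add: chd_def)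

lemma ctl_Cons [simp]: "ctl (Suc (prod_encode (x, c))) = c"
  by (simp add: ctl_def)

lemma ctl_list_encode [simp]: "ctl (list_encode xs) = list_encode (tl xs)"
proof (cases xs)
  case Nil
  have "prod_decode 0 = (0, 0)" by (simp add: prod_decode_def prod_decode_aux.simps)
  with Nil show ?thesis by (simp add: ctl_def)
qed (simp add: ctl_def)

lemma cdrop_list_encode [simp]: "cdrop k (list_encode xs) = list_encode (drop k xs)"
  by (induction k) (simp_all add: cdrop_def tl_drop drop_Suc)

lemma length_le_list_encode: "length xs \<le> list_encode xs"
proof (induction xs)
  case (Cons x xs)
  then show ?case using le_prod_encode_2[of "list_encode xs" x] by simp
qed simp

lemma clength_list_encode [simp]: "clength (list_encode xs) = length xs"
proof -
  have "rec_nat 0 (\<lambda>i r. if cdrop i (list_encode xs) = 0 then r else Suc r) k = min k (length xs)" for k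
    by (induction k) auto
  then show ?thesis using length_le_list_encode[of xs] by (simp add: clength_def)
qed

lemma crev_list_encode [simp]: "crev (list_encode xs) = list_encode (rev xs)"
proof -
  have "rec_nat 0 (\<lambda>i r. if cdrop i (list_encode xs) = 0 then r
      else Suc (prod_encode (chd (cdrop i (list_encode xs)), r))) k = list_encode (rev (take k xs))" for k
  proof (induction k)
    case (Suc k)
    show ?case
    proof (cases "k < length xs")
      case True
      then show ?thesis using Suc
        by (simp add: take_Suc_conv_app_nth flip: Cons_nth_drop_Suc)
    qed (use Suc in simp)
  qed simp
  then show ?thesis using length_le_list_encode[of xs] by (simp add: crev_def)
qed

section \<open>Step-bounded evaluation\<close>

text \<open>The value 0 means that no result is known at stage \<open>t\<close>, and \<open>Suc y\<close> stands for the
  result \<open>y\<close>. In the search for \<open>Mu\<close> the accumulator is 0 while searching, 1 after meeting an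
  undecided value, and \<open>k + 2\<close> after finding \<open>k\<close>.\<close>

primrec stage :: "prog \<Rightarrow> nat \<Rightarrow> nat \<Rightarrow> nat" where
  "stage Zero = (\<lambda>x t. 1)"
| "stage Succ = (\<lambda>x t. Suc (Suc x))"
| "stage Fst = (\<lambda>x t. Suc (p1 x))"
| "stage Snd = (\<lambda>x t. Suc (p2 x))"
| "stage (Pair p q) = (\<lambda>x t. if stage p x t = 0 then 0 else if stage q x t = 0 then 0
     else Suc (prod_encode (stage p x t - 1, stage q x t - 1)))"
| "stage (Comp p q) = (\<lambda>x t. if stage q x t = 0 then 0 else stage p (stage q x t - 1) t)"
| "stage (Prec p q) = (\<lambda>x t. rec_nat (stage p (p1 x) t)
     (\<lambda>i r. if r = 0 then 0 else stage q (prod_encode (p1 x, prod_encode (i, r - 1))) t) (p2 x))"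
| "stage (Mu p) = (\<lambda>x t. rec_nat 0
     (\<lambda>j r. if r = 0 then
        if stage p (prod_encode (x, j)) t = 0 then 1
        else if stage p (prod_encode (x, j)) t = 1 then Suc (Suc j) else 0
      else r) t - 1)"

text \<open>With \<open>X\<close> and \<open>T\<close> arbitrary, the induction hypotheses reach the
  composite arguments inside the recursions.\<close>

lemma recfn_stage: "recfn X \<Longrightarrow> recfn T \<Longrightarrow> recfn (\<lambda>x. stage p (X x) (T x))"
proof (induction p arbitrary: X T)
  case (Prec p q)
  then show ?case by simp (intro recfn_intros Prec recfn_comp[OF Prec(3)] recfn_comp[OF Prec(4)])
next
  case (Mu p)
  then show ?case by simp (intro recfn_intros Mu recfn_comp[OF Mu(2)] recfn_comp[OF Mu(3)])
qed (simp_all add: recfn_intros)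

lemma stage_sound: "stage p x t = Suc y \<Longrightarrow> eval_prog p x = Some y"
proof (induction p arbitrary: x y)
  case (Pair p q)
  from Pair.prems obtain u v where "stage p x t = Suc u" "stage q x t = Suc v"
    by (cases "stage p x t"; cases "stage q x t") auto
  with Pair show ?case by auto
next
  case (Comp p q)
  from Comp.prems obtain u where "stage q x t = Suc u"
    by (cases "stage q x t") auto
  with Comp show ?case by auto
next
  case (Prec p q)
  let ?S = "rec_nat (stage p (p1 x) t)
     (\<lambda>i r. if r = 0 then 0 else stage q (prod_encode (p1 x, prod_encode (i, r - 1))) t)"
  let ?E = "rec_nat (eval_prog p (p1 x))
       (\<lambda>i r. do { v \<leftarrow> r; eval_prog q (prod_encode (p1 x, prod_encode (i, v))) })"
  have "?S k = Suc y \<Longrightarrow> ?E k = Some y" for k y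
  proof (induction k arbitrary: y)
    case 0
    then show ?case using Prec.IH(1) by simp
  next
    case (Suc k)
    then obtain r where "?S k = Suc r" by (cases "?S k") auto
    with Suc show ?case using Prec.IH(2) by auto
  qed
  then show ?case using Prec.prems by (simp add: case_prod_beta)
next
  case (Mu p)
  let ?A = "rec_nat 0
     (\<lambda>j r. if r = 0 then
        if stage p (prod_encode (x, j)) t = 0 then 1
        else if stage p (prod_encode (x, j)) t = 1 then Suc (Suc j) else 0
      else r)"
  have searching: "?A k = 0 \<Longrightarrow> \<forall>j<k. \<exists>v. stage p (prod_encode (x, j)) t = Suc (Suc v)" for k
  proof (induction k)
    case (Suc k)
    then have "?A k = 0" by (auto split: if_splits)
    moreover from this Suc.prems have "\<exists>v. stage p (prod_encode (x, k)) t = Suc (Suc v)"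
      by (cases "stage p (prod_encode (x, k)) t"; cases "stage p (prod_encode (x, k)) t - 1") auto
    ultimately show ?case using Suc.IH by (simp add: less_Suc_eq)
  qed simp
  have found: "?A k = Suc (Suc m) \<Longrightarrow> stage p (prod_encode (x, m)) t = 1 \<and>
      (\<forall>j<m. \<exists>v. stage p (prod_encode (x, j)) t = Suc (Suc v))" for k m
  proof (induction k)
    case (Suc k)
    show ?case
    proof (cases "?A k = 0")
      case True
      with Suc.prems have "m = k" "stage p (prod_encode (x, k)) t = 1" by (auto split: if_splits)
      with searching[OF True] show ?thesis by simp
    qed (use Suc in simp)
  qed simp
  \<comment> \<open>The final subtraction in \<open>stage\<close> sends accumulators 0 and 1 to 0,
    so a positive result means that the search succeeded.\<close>
  from Mu.prems have "?A t = Suc (Suc y)" by simp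
  from found[OF this] have min: "eval_prog p (prod_encode (x, y)) = Some 0"
    "\<forall>j<y. \<exists>v. eval_prog p (prod_encode (x, j)) = Some (Suc v)"
    using Mu.IH by (simp, blast)
  then have "(THE k. eval_prog p (prod_encode (x, k)) = Some 0 \<and>
     (\<forall>j<k. \<exists>v. eval_prog p (prod_encode (x, j)) = Some (Suc v))) = y"
    by (intro the_equality) (auto, metis linorder_neqE_nat option.inject nat.distinct(1))
  with min show ?case unfolding eval_prog.simps Let_def by auto
qed simp_all

text \<open>A convergent evaluation has finitely many subcomputations, so their eventual statements
  can be intersected.\<close>

lemma stage_complete:
  "eval_prog p x = Some y \<Longrightarrow> \<forall>\<^sub>F t in at_top. stage p x t = Suc y"
proof (induction p arbitrary: x y)
  case (Pair p q)
  from Pair.prems obtain u v where uv: "eval_prog p x = Some u" "eval_prog q x = Some v"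
    "y = prod_encode (u, v)"
    by (auto simp: bind_eq_Some_conv)
  from Pair.IH(1)[OF uv(1)] Pair.IH(2)[OF uv(2)] show ?case
    by eventually_elim (simp add: uv)
next
  case (Comp p q)
  from Comp.prems obtain u where u: "eval_prog q x = Some u" "eval_prog p u = Some y"
    by (auto simp: bind_eq_Some_conv)
  from Comp.IH(1)[OF u(2)] Comp.IH(2)[OF u(1)] show ?case
    by eventually_elim simp
next
  case (Prec p q)
  let ?S = "\<lambda>t. rec_nat (stage p (p1 x) t)
     (\<lambda>i r. if r = 0 then 0 else stage q (prod_encode (p1 x, prod_encode (i, r - 1))) t)"
  let ?E = "rec_nat (eval_prog p (p1 x))
       (\<lambda>i r. do { v \<leftarrow> r; eval_prog q (prod_encode (p1 x, prod_encode (i, v))) })"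
  have "?E k = Some y \<Longrightarrow> \<forall>\<^sub>F t in at_top. ?S t k = Suc y" for k y
  proof (induction k arbitrary: y)
    case 0
    then show ?case using Prec.IH(1) by simp
  next
    case (Suc k)
    from Suc.prems obtain v where v: "?E k = Some v"
      "eval_prog q (prod_encode (p1 x, prod_encode (k, v))) = Some y"
      by (auto simp: bind_eq_Some_conv)
    from Suc.IH[OF v(1)] Prec.IH(2)[OF v(2)] show ?case
      by eventually_elim simp
  qed
  then show ?case using Prec.prems by (simp add: case_prod_beta)
next
  case (Mu p)
  let ?min = "\<lambda>k. eval_prog p (prod_encode (x, k)) = Some 0 \<and>
     (\<forall>j<k. \<exists>v. eval_prog p (prod_encode (x, j)) = Some (Suc v))"
  let ?A = "\<lambda>t. rec_nat 0
     (\<lambda>j r. if r = 0 then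
        if stage p (prod_encode (x, j)) t = 0 then 1
        else if stage p (prod_encode (x, j)) t = 1 then Suc (Suc j) else 0
      else r)"
  from Mu.prems have ex: "\<exists>k. ?min k" and y: "y = (THE k. ?min k)"
    by (auto simp: Let_def split: if_splits)
  from ex obtain k where k: "?min k" by blast
  then have "(THE k. ?min k) = k"
    by (intro the_equality) (auto, metis linorder_neqE_nat option.inject nat.distinct(1))
  with k y have min: "?min y" by simp
  have "\<forall>\<^sub>F t in at_top. \<forall>j\<in>{..<y}. \<exists>v. stage p (prod_encode (x, j)) t = Suc (Suc v)"
  proof (intro eventually_ball_finite ballI)
    fix j assume "j \<in> {..<y}"
    with min obtain v where "eval_prog p (prod_encode (x, j)) = Some (Suc v)" by auto
    from Mu.IH[OF this] show "\<forall>\<^sub>F t in at_top. \<exists>v. stage p (prod_encode (x, j)) t = Suc (Suc v)"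
      by eventually_elim simp
  qed simp
  moreover have "\<forall>\<^sub>F t in at_top. stage p (prod_encode (x, y)) t = Suc 0"
    using Mu.IH min by blast
  ultimately show ?case using eventually_gt_at_top[of y]
  proof eventually_elim
    case (elim t)
    have "k \<le> y \<Longrightarrow> ?A t k = 0" for k
    proof (induction k)
      case (Suc k)
      then have "\<exists>v. stage p (prod_encode (x, k)) t = Suc (Suc v)" using elim(1) by simp
      with Suc show ?case by auto
    qed simp
    then have "?A t (Suc y) = Suc (Suc y)" using elim(2) by simp
    \<comment> \<open>A nonzero accumulator is frozen, so the value survives until the bound
      \<open>t\<close>.\<close>
    then have "?A t (Suc y + d) = Suc (Suc y)" for d
      by (induction d) auto
    from this[of "t - Suc y"] have "?A t t = Suc (Suc y)" using elim(3) by simp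
    then show ?case by simp
  qed
qed simp_all

section \<open>Simulating an oracle computation from a finite part of the oracle\<close>

text \<open>The argument \<open>H\<close> codes \<open>n # [h 0, \<dots>, h (s - 1)]\<close>. A state \<open>\<langle>0, c\<rangle>\<close> is a running
  computation whose history, reversed, is coded by \<open>c\<close>; the state \<open>\<langle>1, q\<rangle>\<close> has halted with
  output \<open>q\<close>. A step that cannot be carried out leaves the state unchanged.\<close>

definition sim_step :: "prog \<Rightarrow> nat \<Rightarrow> nat \<Rightarrow> nat" where
  "sim_step p H st =
     (if p1 st = 0 then
        let r = stage p (crev (p2 st)) (clength H); D = cdrop (Suc ((r - 1) div 2)) H in
        if r = 0 then st
        else if (r - 1) mod 2 = 1 then prod_encode (1, (r - 1) div 2)
        else if D = 0 then st
        else prod_encode (0, Suc (prod_encode (chd D, p2 st)))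
      else st)"

text \<open>The length of \<open>H\<close> bounds both the number of steps and the stage used in
  each, so one parameter controls the whole approximation.\<close>

definition sim :: "prog \<Rightarrow> nat \<Rightarrow> nat \<Rightarrow> nat" where
  "sim p H x = (sim_step p H ^^ clength H) (prod_encode (0, Suc (prod_encode (x, 0))))"

lemma recfn_sim:
  assumes "recfn H" "recfn X"
  shows "recfn (\<lambda>x. sim p (H x) (X x))"
  unfolding sim_def sim_step_def Let_def
  by (intro recfn_intros recfn_stage assms recfn_comp[OF assms(1)])

lemma crev_conv: "crev c = list_encode (rev (list_decode c))"
  using crev_list_encode[of "list_decode c"] by simp

text \<open>The \<open>Suc\<close> skips the input \<open>n\<close> at the head; 0 signals a query
  outside the known part of \<open>h\<close>.\<close>

lemma cdrop_oracle:
  "cdrop (Suc q) (list_encode (n # map h [0..<s])) =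
     (if q < s then Suc (prod_encode (h q, list_encode (map h [Suc q..<s]))) else 0)"
  unfolding cdrop_list_encode
  by (simp add: drop_map upt_conv_Cons)

lemma sim_sound:
  assumes "sim (prog_of e) (list_encode (n # map h [0..<s])) x = prod_encode (1, q)"
  shows "seq_comp (Phi e) (Some \<circ> h) x = Some q"
proof -
  define H where "H = list_encode (n # map h [0..<s])"
  \<comment> \<open>The true outcome of the computation from a state is an invariant of the
    simulation.\<close>
  define val where "val st = (if p1 st = 0
    then seq_run (Phi e) (Some \<circ> h) (rev (list_decode (p2 st))) else Some (p2 st))" for st
  have step: "val (sim_step (prog_of e) H st) = val st" for st
  proof (cases "p1 st = 0 \<and> stage (prog_of e) (crev (p2 st)) (clength H) \<noteq> 0")
    case True
    then obtain v where v: "stage (prog_of e) (crev (p2 st)) (clength H) = Suc v"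
      using not0_implies_Suc by blast
    have phi: "Phi e (rev (list_decode (p2 st))) = Some (odd v, v div 2)"
      using stage_sound[OF v] by (simp add: Phi_def crev_conv)
    have D: "cdrop (Suc (v div 2)) H = (if v div 2 < s then
        Suc (prod_encode (h (v div 2), list_encode (map h [Suc (v div 2)..<s]))) else 0)"
      unfolding H_def by (rule cdrop_oracle)
    have val: "val st = seq_run (Phi e) (Some \<circ> h) (rev (list_decode (p2 st)))"
      using True by (simp add: val_def)
    have run: "seq_run (Phi e) (Some \<circ> h) (rev (list_decode (p2 st))) =
        (if odd v then Some (v div 2)
         else seq_run (Phi e) (Some \<circ> h) (rev (list_decode (p2 st)) @ [h (v div 2)]))"
      by (subst seq_run.simps) (simp add: phi)
    show ?thesis
    proof (cases "even v \<and> \<not> v div 2 < s")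
      case False
      with True show ?thesis unfolding val run
        by (auto simp: sim_step_def v D val_def odd_iff_mod_2_eq_one)
    qed (use True in \<open>simp add: sim_step_def v D\<close>)
  qed (auto simp: sim_step_def)
  have "val ((sim_step (prog_of e) H ^^ k) st) = val st" for k st
    by (induction k) (simp_all add: step)
  from this[of "clength H" "prod_encode (0, Suc (prod_encode (x, 0)))"]
  show ?thesis using assms[folded H_def, unfolded sim_def]
    by (simp add: val_def seq_comp_def)
qed

text \<open>A halting computation makes finitely many evaluations and queries, all available once
  \<open>s\<close> is large.\<close>

lemma sim_complete:
  assumes "seq_comp (Phi e) (Some \<circ> h) x = Some q"
  shows "\<forall>\<^sub>F s in at_top. sim (prog_of e) (list_encode (n # map h [0..<s])) x = prod_encode (1, q)"
proof -
  let ?H = "\<lambda>s. list_encode (n # map h [0..<s])"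
  let ?step = "\<lambda>s. sim_step (prog_of e) (?H s)"
  have len: "clength (?H s) = Suc s" for s
    by (simp only: clength_list_encode) simp
  \<comment> \<open>Fixed-point induction also generalises \<open>\<Phi>\<close> and
    \<open>g\<close>; the equations pin them down again.\<close>
  have reach: "\<Phi> = Phi e \<longrightarrow> g = Some \<circ> h \<longrightarrow> (\<exists>k. \<forall>\<^sub>F s in at_top.
      (?step s ^^ k) (prod_encode (0, list_encode (rev xs))) = prod_encode (1, y))"
    if "seq_run \<Phi> g xs = Some y" for \<Phi> g xs y
    using that
  proof (induct rule: seq_run.raw_induct[rotated, consumes 1, case_names step])
    case (step run \<Phi> g xs y)
    show ?case
    proof (intro impI)
      assume [simp]: "\<Phi> = Phi e" "g = Some \<circ> h"
      from step(2) obtain v where v: "eval_prog (prog_of e) (list_encode xs) = Some v"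
        by (auto simp: Phi_def bind_eq_Some_conv)
      have stage: "\<forall>\<^sub>F s in at_top. stage (prog_of e) (list_encode xs) (Suc s) = Suc v"
        using stage_complete[OF v] unfolding eventually_at_top_linorder by (meson le_SucI)
      show "\<exists>k. \<forall>\<^sub>F s in at_top.
        (?step s ^^ k) (prod_encode (0, list_encode (rev xs))) = prod_encode (1, y)"
      proof (cases "odd v")
        case True
        with step(2) v have y: "y = v div 2" by (simp add: Phi_def)
        have "\<forall>\<^sub>F s in at_top.
          (?step s ^^ 1) (prod_encode (0, list_encode (rev xs))) = prod_encode (1, y)"
          using stage
          by eventually_elim
            (use True y in \<open>simp add: sim_step_def len odd_iff_mod_2_eq_one del: list_encode.simps\<close>)
        then show ?thesis by blast
      next
        case False
        with step(2) v have "run (Phi e) (Some \<circ> h) (xs @ [h (v div 2)]) = Some y"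
          by (simp add: Phi_def)
        from step(1)[OF this] obtain k where k: "\<forall>\<^sub>F s in at_top. (?step s ^^ k)
            (prod_encode (0, list_encode (rev (xs @ [h (v div 2)])))) = prod_encode (1, y)"
          by auto
        have "\<forall>\<^sub>F s in at_top.
          (?step s ^^ Suc k) (prod_encode (0, list_encode (rev xs))) = prod_encode (1, y)"
          using stage k eventually_gt_at_top[of "v div 2"]
        proof eventually_elim
          case (elim s)
          have "?step s (prod_encode (0, list_encode (rev xs))) =
              prod_encode (0, list_encode (rev (xs @ [h (v div 2)])))"
            unfolding sim_step_def Let_def len using elim(1,3) False
            by (simp add: cdrop_oracle[unfolded list_encode.simps] even_iff_mod_2_eq_zero
              del: cdrop_list_encode)
          with elim(2) show ?case by (simp only: funpow_Suc_right o_apply)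
        qed
        then show ?thesis by blast
      qed
    qed
  qed
  from reach[OF assms[unfolded seq_comp_def]] obtain k where
    k: "\<forall>\<^sub>F s in at_top. (?step s ^^ k) (prod_encode (0, list_encode (rev [x]))) = prod_encode (1, q)"
    by auto
  \<comment> \<open>Surplus steps do no harm.\<close>
  have halted: "(?step s ^^ j) (prod_encode (1, q)) = prod_encode (1, q)" for s j
    by (induction j) (simp_all add: sim_step_def)
  from k eventually_ge_at_top[of k] show ?thesis
  proof eventually_elim
    case (elim s)
    have "(?step s ^^ Suc s) st = (?step s ^^ (Suc s - k)) ((?step s ^^ k) st)" for st
      using elim(2) by (simp only: flip: funpow_add[THEN fun_cong, unfolded o_apply]) simp
    with elim(1) halted show ?case unfolding sim_def len by simp
  qed
qed

section \<open>Unbounded search relative to a total oracle\<close>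

text \<open>Query \<open>h 0\<close>, \<open>h 1\<close>, and so on in order: the history is then
  exactly the list that \<open>W\<close> inspects. Even outputs query the next position, odd ones
  halt.\<close>

lemma subT_le_search:
  assumes W: "recfn W"
    and sound: "\<And>n s y. W (list_encode (n # map h [0..<s])) = Suc y \<Longrightarrow> y = f n"
    and found: "\<And>n. \<exists>s. W (list_encode (n # map h [0..<s])) \<noteq> 0"
  shows "(Some \<circ> f) \<le>\<^sub>s\<^sub>u\<^sub>b\<^sub>T (Some \<circ> h)"
proof -
  have "recfn (\<lambda>c. if W c = 0 then 2 * (clength c - 1) else Suc (2 * (W c - 1)))"
    by (intro recfn_intros W)
  then obtain e where e: "\<And>c. eval_prog (prog_of e) c =
      Some (if W c = 0 then 2 * (clength c - 1) else Suc (2 * (W c - 1)))"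
    unfolding recfn_def using surj_prog_of by metis
  have "seq_comp (Phi e) (Some \<circ> h) n = Some (f n)" for n
  proof -
    let ?xs = "\<lambda>s. n # map h [0..<s]"
    have phi: "Phi e (?xs s) =
        Some (if W (list_encode (?xs s)) = 0 then (False, s) else (True, f n))" for s
    proof (cases "W (list_encode (?xs s))")
      case 0
      then show ?thesis unfolding Phi_def e by (simp del: list_encode.simps)
    next
      case (Suc y)
      with sound[OF Suc] show ?thesis unfolding Phi_def e by (simp del: list_encode.simps)
    qed
    obtain s0 where s0: "W (list_encode (?xs s0)) \<noteq> 0" using found by blast
    \<comment> \<open>Downward induction from \<open>s0\<close>; an earlier halt also yields
      \<open>f n\<close>, by \<open>sound\<close>.\<close>
    have "seq_run (Phi e) (Some \<circ> h) (?xs s) = Some (f n)" if "s \<le> s0" for s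
      using that
    proof (induction s rule: inc_induct)
      case base
      show ?case using s0 by (subst seq_run.simps) (simp add: phi del: list_encode.simps)
    next
      case (step s)
      then show ?case by (subst seq_run.simps) (simp add: phi comp_def del: list_encode.simps)
    qed
    from this[of 0] show ?thesis by (simp add: seq_comp_def)
  qed
  then have "(Some \<circ> f) \<subseteq>\<^sub>m seq_comp (Phi e) (Some \<circ> h)"
    by (simp add: map_le_def)
  then show ?thesis unfolding subT_le_def ..
qed

text \<open>A witness passes a decidable test \<open>G\<close> and two tests enumerable in
  \<open>h\<close>, matching a certificate made of two points.\<close>

lemma subT_le_search_comp:
  assumes rec: "recfn G" "recfn C" "recfn C'" "recfn F"
    and sound: "\<And>n w. G (prod_encode (n, w)) = 0 \<Longrightarrow>
      seq_comp (Phi e) (Some \<circ> h) (C (prod_encode (n, w))) = Some 0 \<Longrightarrow>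
      seq_comp (Phi e) (Some \<circ> h) (C' (prod_encode (n, w))) = Some 0 \<Longrightarrow>
      F (prod_encode (n, w)) = f n"
    and found: "\<And>n. \<exists>w. G (prod_encode (n, w)) = 0 \<and>
      seq_comp (Phi e) (Some \<circ> h) (C (prod_encode (n, w))) = Some 0 \<and>
      seq_comp (Phi e) (Some \<circ> h) (C' (prod_encode (n, w))) = Some 0"
  shows "(Some \<circ> f) \<le>\<^sub>s\<^sub>u\<^sub>b\<^sub>T (Some \<circ> h)"
proof (rule subT_le_search)
  \<comment> \<open>At stage \<open>s = \<langle>w, k\<rangle>\<close> the candidate \<open>w\<close> is tested, so each candidate is tested at
    arbitrarily late stages.\<close>
  let ?z = "\<lambda>c. prod_encode (chd c, p1 (clength c - 1))"
  let ?W = "\<lambda>c. if G (?z c) = 0 then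
      if sim (prog_of e) c (C (?z c)) = prod_encode (1, 0) then
        if sim (prog_of e) c (C' (?z c)) = prod_encode (1, 0) then Suc (F (?z c)) else 0
      else 0
    else 0"
  show "recfn ?W"
    by (intro recfn_intros recfn_sim rec[THEN recfn_comp])
  have z: "?z (list_encode (n # map h [0..<s])) = prod_encode (n, p1 s)" for n s
    unfolding clength_list_encode by simp
  show "y = f n" if "?W (list_encode (n # map h [0..<s])) = Suc y" for n s y
    using that unfolding z
    by (auto split: if_splits dest!: sim_sound simp: sound simp del: list_encode.simps One_nat_def)
  show "\<exists>s. ?W (list_encode (n # map h [0..<s])) \<noteq> 0" for n
  proof -
    obtain w where w: "G (prod_encode (n, w)) = 0"
      "seq_comp (Phi e) (Some \<circ> h) (C (prod_encode (n, w))) = Some 0"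
      "seq_comp (Phi e) (Some \<circ> h) (C' (prod_encode (n, w))) = Some 0"
      using found by blast
    from eventually_conj[OF sim_complete[OF w(2)] sim_complete[OF w(3)]]
    obtain k where k: "\<And>s. s \<ge> k \<Longrightarrow>
      sim (prog_of e) (list_encode (n # map h [0..<s])) (C (prod_encode (n, w))) = prod_encode (1, 0) \<and>
      sim (prog_of e) (list_encode (n # map h [0..<s])) (C' (prod_encode (n, w))) = prod_encode (1, 0)"
      unfolding eventually_at_top_linorder by blast
    have "?W (list_encode (n # map h [0..<prod_encode (w, k)])) \<noteq> 0"
      unfolding z using k[of "prod_encode (w, k)", OF le_prod_encode_2] w(1)
      by (simp del: list_encode.simps)
    then show ?thesis ..
  qed
qed

text \<open>The history length separates the query phase from the halting phase; one index serves
  every total oracle.\<close>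

lemma single_query_index:
  assumes "recfn A" "recfn B"
  shows "\<exists>e. \<forall>f n. seq_comp (Phi e) (Some \<circ> f) n = Some (B (prod_encode (n, f (A n))))"
proof -
  have "recfn (\<lambda>c. if ctl c = 0 then 2 * A (chd c)
      else Suc (2 * B (prod_encode (chd c, chd (ctl c)))))"
    by (intro recfn_intros assms[THEN recfn_comp])
  then obtain e where e: "\<And>c. eval_prog (prog_of e) c = Some (if ctl c = 0 then 2 * A (chd c)
      else Suc (2 * B (prod_encode (chd c, chd (ctl c)))))"
    unfolding recfn_def using surj_prog_of by metis
  have "Phi e [n] = Some (False, A n)" "Phi e [n, a] = Some (True, B (prod_encode (n, a)))" for n a
    by (simp_all add: Phi_def e)
  then have "seq_comp (Phi e) (Some \<circ> f) n = Some (B (prod_encode (n, f (A n))))" for f n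
    unfolding seq_comp_def by (subst seq_run.simps, simp, subst seq_run.simps, simp)
  then show ?thesis by blast
qed

section \<open>The cross argument for total functions\<close>

theorem theorem4p6:
  fixes f g h :: "nat \<Rightarrow> nat"
  assumes "(Some \<circ> f) \<sqinter>\<^sub>s\<^sub>u\<^sub>b\<^sub>T (Some \<circ> g) \<le>\<^sub>s\<^sub>u\<^sub>b\<^sub>T (Some \<circ> h)"
  shows "(Some \<circ> f) \<le>\<^sub>s\<^sub>u\<^sub>b\<^sub>T (Some \<circ> h) \<or> (Some \<circ> g) \<le>\<^sub>s\<^sub>u\<^sub>b\<^sub>T (Some \<circ> h)"
proof -
  obtain i where i: "(Some \<circ> f) \<sqinter>\<^sub>s\<^sub>u\<^sub>b\<^sub>T (Some \<circ> g) \<subseteq>\<^sub>m seq_comp (Phi i) (Some \<circ> h)"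
    using assms unfolding subT_le_def by blast
  \<comment> \<open>The unreduced pairing exhibits \<open>B\<close> applied to input and answer, so
    that \<open>single_query_index\<close> matches.\<close>
  have "\<exists>d. \<forall>f n. seq_comp (Phi d) (Some \<circ> f) n =
      Some (if p2 (prod_encode (n, f (p1 (p1 n)))) = p1 (p2 (p1 (prod_encode (n, f (p1 (p1 n)))))) then 0 else 1)"
    by (rule single_query_index) (intro recfn_intros)+
  then obtain d where d: "\<And>f n. seq_comp (Phi d) (Some \<circ> f) n =
      Some (if f (p1 (p1 n)) = p1 (p2 n) then 0 else 1)"
    by auto
  have "\<exists>d. \<forall>f n. seq_comp (Phi d) (Some \<circ> f) n =
      Some (if p2 (prod_encode (n, f (p2 (p1 n)))) = p2 (p2 (p1 (prod_encode (n, f (p2 (p1 n)))))) then 0 else 1)"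
    by (rule single_query_index) (intro recfn_intros)+
  then obtain e where e: "\<And>f n. seq_comp (Phi e) (Some \<circ> f) n =
      Some (if f (p2 (p1 n)) = p2 (p2 n) then 0 else 1)"
    by auto
  define code where "code a b u v =
    prod_encode (d, prod_encode (e, prod_encode (prod_encode (a, b), prod_encode (u, v))))" for a b u v
  define S where "S a b u v \<longleftrightarrow> seq_comp (Phi i) (Some \<circ> h) (code a b u v) = Some 0" for a b u v
  \<comment> \<open>On the cross but off its center the tests disagree, so the meet constrains
    nothing there.\<close>
  have meet: "((Some \<circ> f) \<sqinter>\<^sub>s\<^sub>u\<^sub>b\<^sub>T (Some \<circ> g)) (code a b u v) =
      (if (f a = u) = (g b = v) then Some (if f a = u then 0 else 1) else None)" for a b u v
    by (simp add: subT_meet_def code_def d e)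
  have val: "seq_comp (Phi i) (Some \<circ> h) (code a b u v) = Some (if f a = u then 0 else 1)"
    if "(f a = u) = (g b = v)" for a b u v
    using bspec[OF i[unfolded map_le_def], of "code a b u v"] meet[of a b u v] that
    by (simp add: domIff)
  have center: "S a b (f a) (g b)" for a b
    using val[of a "f a" b "g b"] by (simp add: S_def)
  have cross: "u = f a \<or> v = g b" if "S a b u v" for a b u v
  proof (rule ccontr)
    assume "\<not> (u = f a \<or> v = g b)"
    then show False using val[of a u b v] that by (auto simp: S_def)
  qed
  show ?thesis
  proof (cases "\<forall>b. \<exists>a v u u'. u \<noteq> u' \<and> S a b u v \<and> S a b u' v")
    case True
    \<comment> \<open>A witness for \<open>b\<close> is \<open>\<langle>\<langle>a, v\<rangle>, \<langle>u, u'\<rangle>\<rangle>\<close>.\<close>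
    let ?b = "p1" and ?a = "\<lambda>z. p1 (p1 (p2 z))" and ?v = "\<lambda>z. p2 (p1 (p2 z))"
      and ?u = "\<lambda>z. p1 (p2 (p2 z))" and ?u' = "\<lambda>z. p2 (p2 (p2 z))"
    have "(Some \<circ> g) \<le>\<^sub>s\<^sub>u\<^sub>b\<^sub>T (Some \<circ> h)"
    proof (rule subT_le_search_comp)
      show "recfn (\<lambda>z. if ?u z = ?u' z then 1 else 0)"
        "recfn (\<lambda>z. code (?a z) (?b z) (?u z) (?v z))"
        "recfn (\<lambda>z. code (?a z) (?b z) (?u' z) (?v z))" "recfn ?v"
        unfolding code_def by (intro recfn_intros)+
    next
      fix n w
      let ?z = "prod_encode (n, w)"
      assume "(if ?u ?z = ?u' ?z then 1 else 0 :: nat) = 0"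
        "seq_comp (Phi i) (Some \<circ> h) (code (?a ?z) (?b ?z) (?u ?z) (?v ?z)) = Some 0"
        "seq_comp (Phi i) (Some \<circ> h) (code (?a ?z) (?b ?z) (?u' ?z) (?v ?z)) = Some 0"
      then show "?v ?z = g n"
        using cross[of "?a ?z" n "?u ?z" "?v ?z"] cross[of "?a ?z" n "?u' ?z" "?v ?z"]
        by (auto simp: S_def split: if_splits)
    next
      fix n
      from True obtain a v u u' where *: "u \<noteq> u'" "S a n u v" "S a n u' v" by blast
      show "\<exists>w. (if ?u (prod_encode (n, w)) = ?u' (prod_encode (n, w)) then 1 else 0 :: nat) = 0 \<and>
        seq_comp (Phi i) (Some \<circ> h) (code (?a (prod_encode (n, w))) (?b (prod_encode (n, w)))
          (?u (prod_encode (n, w))) (?v (prod_encode (n, w)))) = Some 0 \<and>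
        seq_comp (Phi i) (Some \<circ> h) (code (?a (prod_encode (n, w))) (?b (prod_encode (n, w)))
          (?u' (prod_encode (n, w))) (?v (prod_encode (n, w)))) = Some 0"
        by (rule exI[of _ "prod_encode (prod_encode (a, v), prod_encode (u, u'))"])
          (use * in \<open>simp add: S_def\<close>)
    qed
    then show ?thesis ..
  next
    case False
    \<comment> \<open>This \<open>b\<close> is built into the program for \<open>f\<close> as a
      constant.\<close>
    then obtain b where b: "\<And>a v u u'. S a b u v \<Longrightarrow> S a b u' v \<Longrightarrow> u = u'" by blast
    have column: "u = f a" if "S a b u v" for a u v
      \<comment> \<open>If \<open>v = g b\<close>, compare with the center, which has the same
        second coordinate.\<close>
      using cross[OF that] b[of a u v "f a"] center[of a b] that by auto
    have "(Some \<circ> f) \<le>\<^sub>s\<^sub>u\<^sub>b\<^sub>T (Some \<circ> h)"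
    proof (rule subT_le_search_comp)
      \<comment> \<open>A single point suffices: \<open>G\<close> is trivial and both enumerable
        tests coincide.\<close>
      show "recfn (\<lambda>z. 0)"
        "recfn (\<lambda>z. code (p1 z) b (p1 (p2 z)) (p2 (p2 z)))"
        "recfn (\<lambda>z. code (p1 z) b (p1 (p2 z)) (p2 (p2 z)))" "recfn (\<lambda>z. p1 (p2 z))"
        unfolding code_def by (intro recfn_intros)+
    next
      fix n w
      assume "seq_comp (Phi i) (Some \<circ> h) (code (p1 (prod_encode (n, w))) b
        (p1 (p2 (prod_encode (n, w)))) (p2 (p2 (prod_encode (n, w))))) = Some 0"
      then show "p1 (p2 (prod_encode (n, w))) = f n" using column by (simp add: S_def)
    next
      fix n
      show "\<exists>w. (0::nat) = 0 \<and> seq_comp (Phi i) (Some \<circ> h) (code (p1 (prod_encode (n, w))) b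
          (p1 (p2 (prod_encode (n, w)))) (p2 (p2 (prod_encode (n, w))))) = Some 0 \<and>
        seq_comp (Phi i) (Some \<circ> h) (code (p1 (prod_encode (n, w))) b
          (p1 (p2 (prod_encode (n, w)))) (p2 (p2 (prod_encode (n, w))))) = Some 0"
        by (rule exI[of _ "prod_encode (f n, g b)"]) (use center[of n b] in \<open>simp add: S_def\<close>)
    qed
    then show ?thesis ..
  qed
qed

end
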